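(* We have $$A^{123}(x,q)=I^{123}(x,q)+\frac{x^2}{(1-xq)^2}+1,$$ $$I^{123}(x)=\frac{1-\sqrt{1-4x}}{2x}-\frac{x^2}{(1-x)^2}-1,$$ and for $n\ge1$, $I^{123}_n=C_n-(n-1)$, where $C_n=\frac1{n+1}\binom{2n}{n}$ is the $n$-th Catalan number.
   Context: For a permutation $\pi=\pi_1\cdots\pi_n$ of $[n]$, let $i_\pi$ be the smallest index $i$ with $\{\pi_1,\dots,\pi_i\}=\{1,\dots,i\}$; $\pi$ is indecomposable if $i_\pi=n$ (the empty permutation is not indecomposable). A permutation $\pi$ avoids a pattern $\tau\in\mathfrak S_k$ if no subsequence $\pi_{j_1}\cdots\pi_{j_k}$ ($j_1<\cdots<j_k$) is order-isomorphic to $\tau$. A descent of $\pi$ is an index $i$ with $\pi_i>\pi_{i+1}$. For a pattern $\sigma$, $A^\sigma_{n,i}$ (resp. $I^\sigma_{n,i}$) is the number of $\sigma$-avoiding permutations (resp. $\sigma$-avoiding indecomposable permutations) of $[n]$ with $i$ descents; $A^\sigma(x,q)=1+\sum_{n\ge1}\sum_iA^\sigma_{n,i}x^nq^i$, $I^\sigma(x,q)=\sum_{n\ge1}\sum_iI^\sigma_{n,i}x^nq^i$, $I^\sigma(x)=I^\sigma(x,1)=\sum_{n\ge1}I^\sigma_nx^n$. *)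

theory Defs
  imports
    Complex_Main
    "HOL-Library.Sublist"
    "HOL-Combinatorics.Multiset_Permutations"
    "HOL-Computational_Algebra.Formal_Power_Series"
    "HOL-Computational_Algebra.Polynomial_FPS"
begin

text \<open>
  A permutation of \<open>[n]\<close> is given by its one-line notation, i.e. as an element of
  \<open>permutations_of_set {1..n}\<close>. List positions count from 0, so \<open>\<pi>\<^sub>i\<close> is \<open>p ! (i - 1)\<close>
  and \<open>{\<pi>\<^sub>1, \<dots>, \<pi>\<^sub>i}\<close> is \<open>set (take i p)\<close>.
\<close>

definition first_block :: "nat list \<Rightarrow> nat" where
  "first_block p = (LEAST i. 1 \<le> i \<and> i \<le> length p \<and> set (take i p) = {1..i})"

text \<open>The \<open>LEAST\<close> above is unspecified for the empty permutation, which is excluded here.\<close>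

definition indecomposable :: "nat list \<Rightarrow> bool" where
  "indecomposable p \<longleftrightarrow> p \<noteq> [] \<and> first_block p = length p"

definition order_isomorphic :: "nat list \<Rightarrow> nat list \<Rightarrow> bool" where
  "order_isomorphic xs ys \<longleftrightarrow> length xs = length ys \<and>
     (\<forall>i<length xs. \<forall>j<length xs. xs ! i < xs ! j \<longleftrightarrow> ys ! i < ys ! j)"

definition avoids :: "nat list \<Rightarrow> nat list \<Rightarrow> bool" where
  "avoids p \<tau> \<longleftrightarrow> \<not> (\<exists>xs. subseq xs p \<and> order_isomorphic xs \<tau>)"

definition descents :: "nat list \<Rightarrow> nat" where
  "descents p = card {i. Suc i < length p \<and> p ! i > p ! Suc i}"

definition avoiders :: "nat list \<Rightarrow> nat \<Rightarrow> nat list set" where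
  "avoiders \<sigma> n = {p \<in> permutations_of_set {1..n}. avoids p \<sigma>}"

definition indec_avoiders :: "nat list \<Rightarrow> nat \<Rightarrow> nat list set" where
  "indec_avoiders \<sigma> n = {p \<in> avoiders \<sigma> n. indecomposable p}"

definition A_num :: "nat list \<Rightarrow> nat \<Rightarrow> nat \<Rightarrow> nat" where
  "A_num \<sigma> n i = card {p \<in> avoiders \<sigma> n. descents p = i}"

definition I_num :: "nat list \<Rightarrow> nat \<Rightarrow> nat \<Rightarrow> nat" where
  "I_num \<sigma> n i = card {p \<in> indec_avoiders \<sigma> n. descents p = i}"

text \<open>
  The coefficient of \<open>x\<^sup>n\<close> in each series is a polynomial in \<open>q\<close>, as a permutation of \<open>[n]\<close>
  has at most \<open>n\<close> descents; \<open>coeff_A_poly\<close> and \<open>coeff_I_poly\<close> below confirm that the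
  bound on the summation index loses nothing.
\<close>

definition A_poly :: "nat list \<Rightarrow> nat \<Rightarrow> real poly" where
  "A_poly \<sigma> n = (\<Sum>i\<le>n. monom (real (A_num \<sigma> n i)) i)"

definition I_poly :: "nat list \<Rightarrow> nat \<Rightarrow> real poly" where
  "I_poly \<sigma> n = (\<Sum>i\<le>n. monom (real (I_num \<sigma> n i)) i)"

text \<open>
  Bivariate series are power series in \<open>x\<close> whose coefficients are power series in \<open>q\<close>, so
  \<open>x\<close> is the outer \<open>fps_X\<close> and \<open>q\<close> is the constant series of the inner one. Division is
  available there: \<open>inverse\<close> on \<open>real fps fps\<close> is the multiplicative inverse for every
  series with constant term 1 (see \<open>inverse_denominator\<close> below).
\<close>

abbreviation var_x :: "real fps fps" where
  "var_x \<equiv> fps_X"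

abbreviation var_q :: "real fps fps" where
  "var_q \<equiv> fps_const fps_X"

definition A_gf :: "nat list \<Rightarrow> real fps fps" where
  "A_gf \<sigma> = 1 + Abs_fps (\<lambda>n. if n \<ge> 1 then fps_of_poly (A_poly \<sigma> n) else 0)"

definition I_gf :: "nat list \<Rightarrow> real fps fps" where
  "I_gf \<sigma> = Abs_fps (\<lambda>n. if n \<ge> 1 then fps_of_poly (I_poly \<sigma> n) else 0)"

text \<open>\<open>I\<^sup>\<sigma>(x) = I\<^sup>\<sigma>(x, 1)\<close>, evaluating the polynomial coefficients at \<open>q = 1\<close>:\<close>

definition I_gf1 :: "nat list \<Rightarrow> real fps" where
  "I_gf1 \<sigma> = Abs_fps (\<lambda>n. if n \<ge> 1 then poly (I_poly \<sigma> n) 1 else 0)"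

text \<open>
  The square root of a series with constant term 1, taken with constant term 1.
\<close>

definition fps_sqrt :: "real fps \<Rightarrow> real fps" where
  "fps_sqrt f = fps_radical root 2 f"

definition catalan :: "nat \<Rightarrow> real" where
  "catalan n = 1 / (real n + 1) * real ((2 * n) choose n)"


lemma descents_le_length: "descents p \<le> length p"
proof -
  have "descents p \<le> card {..<length p}"
    unfolding descents_def by (intro card_mono) auto
  then show ?thesis by simp
qed

lemma length_avoiders: "p \<in> avoiders \<sigma> n \<Longrightarrow> length p = n"
  by (auto simp: avoiders_def permutations_of_set_def dest: distinct_card)

lemma finite_avoiders: "finite (avoiders \<sigma> n)"
  by (simp add: avoiders_def)

lemma finite_indec_avoiders: "finite (indec_avoiders \<sigma> n)"
  by (simp add: indec_avoiders_def finite_avoiders)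

lemma descents_avoiders: "p \<in> avoiders \<sigma> n \<Longrightarrow> descents p \<le> n"
  using descents_le_length[of p] length_avoiders[of p] by simp

lemma A_num_eq_0:
  assumes "i > n" shows "A_num \<sigma> n i = 0"
proof -
  have "{p \<in> avoiders \<sigma> n. descents p = i} = {}"
    using assms descents_avoiders[of _ \<sigma> n] by fastforce
  then show ?thesis by (simp only: A_num_def card.empty)
qed

lemma I_num_eq_0:
  assumes "i > n" shows "I_num \<sigma> n i = 0"
proof -
  have "{p \<in> indec_avoiders \<sigma> n. descents p = i} = {}"
    using assms descents_avoiders[of _ \<sigma> n] by (fastforce simp: indec_avoiders_def)
  then show ?thesis by (simp only: I_num_def card.empty)
qed

lemma coeff_A_poly: "coeff (A_poly \<sigma> n) i = real (A_num \<sigma> n i)"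
  by (cases "i \<le> n") (simp_all add: A_poly_def coeff_sum A_num_eq_0)

lemma coeff_I_poly: "coeff (I_poly \<sigma> n) i = real (I_num \<sigma> n i)"
  by (cases "i \<le> n") (simp_all add: I_poly_def coeff_sum I_num_eq_0)

lemma nth_I_gf1: "n \<ge> 1 \<Longrightarrow> fps_nth (I_gf1 \<sigma>) n = real (card (indec_avoiders \<sigma> n))"
proof -
  assume n: "n \<ge> 1"
  have "descents ` indec_avoiders \<sigma> n \<subseteq> {..n}"
    using descents_avoiders[of _ \<sigma> n] by (auto simp: indec_avoiders_def)
  then have "(\<Sum>i\<le>n. \<Sum>p\<in>{p \<in> indec_avoiders \<sigma> n. descents p = i}. 1) = (\<Sum>p\<in>indec_avoiders \<sigma> n. 1::nat)"
    by (intro sum.group) (auto simp: finite_indec_avoiders)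
  then have "card (indec_avoiders \<sigma> n) = (\<Sum>i\<le>n. I_num \<sigma> n i)"
    by (simp add: I_num_def)
  then show ?thesis
    using n by (simp add: I_gf1_def I_poly_def poly_sum poly_monom)
qed

lemma fps_sqrt_square:
  assumes "fps_nth f 0 = 1"
  shows "fps_sqrt f ^ 2 = f" and "fps_nth (fps_sqrt f) 0 = 1"
proof -
  have "fps_radical root (Suc 1) f ^ Suc 1 = f"
    using assms power_radical[of f root 1] by simp
  then show "fps_sqrt f ^ 2 = f"
    by (simp add: fps_sqrt_def numeral_2_eq_2)
  show "fps_nth (fps_sqrt f) 0 = 1"
    using assms by (simp add: fps_sqrt_def fps_radical_def numeral_2_eq_2)
qed

lemma inverse_denominator:
  "(1 - var_x * var_q)\<^sup>2 * inverse ((1 - var_x * var_q)\<^sup>2) = 1"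
  "f / (1 - var_x * var_q)\<^sup>2 = f * inverse ((1 - var_x * var_q)\<^sup>2)"
proof -
  have 0: "fps_nth ((1 - var_x * var_q)\<^sup>2) 0 = 1"
    by (simp add: fps_power_zeroth)
  have "inverse (1 :: real fps) = 1"
    by simp
  then have "inverse ((1 - var_x * var_q)\<^sup>2) = fps_right_inverse ((1 - var_x * var_q)\<^sup>2) 1"
    using 0 by (simp only: fps_inverse_def[of "(1 - var_x * var_q)\<^sup>2"])
  then show "(1 - var_x * var_q)\<^sup>2 * inverse ((1 - var_x * var_q)\<^sup>2) = 1"
    using fps_right_inverse[of "(1 - var_x * var_q)\<^sup>2" 1] 0 by simp
  show "f / (1 - var_x * var_q)\<^sup>2 = f * inverse ((1 - var_x * var_q)\<^sup>2)"
    by (rule fps_divide_unit) (simp add: 0)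
qed

end

(*
  A 123-avoider of [n] is turned into one of [n+1] by inserting n+1 anywhere in or directly behind
  its initial decreasing run. Counting avoiders by a lower bound on the length of that run therefore
  gives the Pascal-type recurrence of the ballot numbers, and the total is a Catalan number.
  If a 123-avoider splits as a direct sum, then an ascent in one summand would extend to a 123 with
  any entry of the other, so both summands are decreasing: there are n-1 such permutations, each
  with n-2 descents. The closed form of the Catalan series is read off the binomial series of
  (1-4x)^(1/2).
*)

theory Submission
  imports Defs
begin

text \<open>Otherwise the simplifier turns the pattern into \<open>[Suc 0, 2, 3]\<close>, which no rule below matches.\<close>

declare One_nat_def [simp del]

section \<open>Words avoiding 123 and decreasing words\<close>

lemma avoids_123_iff:
  "avoids p [1,2,3] \<longleftrightarrow> (\<forall>a b c. subseq [a,b,c] p \<longrightarrow> a < b \<longrightarrow> \<not> b < c)"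
proof -
  have iso: "order_isomorphic xs [1,2,3] \<longleftrightarrow> (\<exists>a b c. xs = [a,b,c] \<and> a < b \<and> b < c)" for xs
  proof
    assume iso: "order_isomorphic xs [1,2,3]"
    then have "length xs = Suc (Suc (Suc 0))" by (simp add: order_isomorphic_def)
    then obtain a b c where xs: "xs = [a,b,c]"
      by (auto simp: length_Suc_conv)
    from iso have "xs ! i < xs ! j \<longleftrightarrow> [1,2,3::nat] ! i < [1,2,3] ! j" if "i < 3" "j < 3" for i j
      using that by (simp add: order_isomorphic_def)
    from this[of 0 1] this[of 1 2] show "\<exists>a b c. xs = [a,b,c] \<and> a < b \<and> b < c"
      by (simp add: xs)
  next
    assume "\<exists>a b c. xs = [a,b,c] \<and> a < b \<and> b < c"
    then show "order_isomorphic xs [1,2,3]"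
      by (auto simp: order_isomorphic_def less_Suc_eq)
  qed
  show ?thesis
    unfolding avoids_def iso by blast
qed

text \<open>The cut is an index bounded by the length of \<open>xs\<close>, so for a list of known
  length the existential unfolds into a finite disjunction over the place of the cut.\<close>

lemma subseq_append_iff_take_drop:
  "subseq xs (u @ v) \<longleftrightarrow> (\<exists>i\<le>length xs. subseq (take i xs) u \<and> subseq (drop i xs) v)"
proof
  assume "subseq xs (u @ v)"
  then obtain xs1 xs2 where "xs = xs1 @ xs2" "subseq xs1 u" "subseq xs2 v"
    by (auto simp: subseq_append_iff)
  then show "\<exists>i\<le>length xs. subseq (take i xs) u \<and> subseq (drop i xs) v"
    by (intro exI[of _ "length xs1"]) simp
next
  assume "\<exists>i\<le>length xs. subseq (take i xs) u \<and> subseq (drop i xs) v"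
  then show "subseq xs (u @ v)"
    by (metis append_take_drop_id list_emb_append_mono)
qed

lemma subseq_append_cases:
  "subseq [a,b] (u @ v) \<longleftrightarrow>
     subseq [a,b] v \<or> a \<in> set u \<and> b \<in> set v \<or> subseq [a,b] u"
  "subseq [a,b,c] (u @ v) \<longleftrightarrow>
     subseq [a,b,c] v \<or> a \<in> set u \<and> subseq [b,c] v \<or> subseq [a,b] u \<and> c \<in> set v
     \<or> subseq [a,b,c] u"
proof -
  have ex: "(\<exists>i\<le>Suc m. P i) \<longleftrightarrow> P 0 \<or> (\<exists>i\<le>m. P (Suc i))" for m and P :: "nat \<Rightarrow> bool"
    by (metis Suc_le_mono not0_implies_Suc zero_le)
  show "subseq [a,b] (u @ v) \<longleftrightarrow>
     subseq [a,b] v \<or> a \<in> set u \<and> b \<in> set v \<or> subseq [a,b] u"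
    by (simp add: subseq_append_iff_take_drop ex subseq_singleton_left)
  show "subseq [a,b,c] (u @ v) \<longleftrightarrow>
     subseq [a,b,c] v \<or> a \<in> set u \<and> subseq [b,c] v \<or> subseq [a,b] u \<and> c \<in> set v
     \<or> subseq [a,b,c] u"
    by (simp add: subseq_append_iff_take_drop ex subseq_singleton_left)
qed

lemma set_mono_subseq: "subseq xs ys \<Longrightarrow> set xs \<subseteq> set ys"
  by (induction rule: list_emb.induct) auto

lemma sorted_wrt_greater_subseq:
  assumes "sorted_wrt (>) p" "subseq [a,b] p"
  shows "b < (a::'a::linorder)"
  using assms
  by (induction p) (auto simp: subseq_singleton_left split: if_splits)

lemma sorted_wrt_greater_iff_subseq:
  fixes p :: "'a::linorder list"
  assumes "distinct p"
  shows "sorted_wrt (>) p \<longleftrightarrow> (\<forall>a b. subseq [a,b] p \<longrightarrow> \<not> a < b)"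
proof
  assume "sorted_wrt (>) p"
  then show "\<forall>a b. subseq [a,b] p \<longrightarrow> \<not> a < b"
    using sorted_wrt_greater_subseq by (metis less_asym)
next
  assume "\<forall>a b. subseq [a,b] p \<longrightarrow> \<not> a < b"
  with assms show "sorted_wrt (>) p"
  proof (induction p)
    case (Cons x p)
    have "y < x" if "y \<in> set p" for y
    proof -
      have "subseq [x,y] (x # p)" using that by (simp add: subseq_singleton_left)
      then show ?thesis using Cons.prems that by (metis distinct.simps(2) linorder_neqE)
    qed
    moreover have "sorted_wrt (>) p"
      using Cons by (metis distinct.simps(2) list_emb_Cons)
    ultimately show ?case by simp
  qed simp
qed

lemma sorted_wrt_greater_unique:
  fixes p q :: "'a::linorder list"
  assumes "sorted_wrt (>) p" "sorted_wrt (>) q" "set p = set q"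
  shows "p = q"
proof -
  have "sorted_wrt (<) (rev p)" "sorted_wrt (<) (rev q)"
    using assms by (simp_all add: sorted_wrt_rev)
  then have "rev p = rev q"
    using assms(3) by (intro strict_sorted_equal) auto
  then show ?thesis by simp
qed

section \<open>Inserting the maximum into a 123-avoider\<close>

lemma in_avoiders_123_iff:
  "p \<in> avoiders [1,2,3] n \<longleftrightarrow> distinct p \<and> set p = {1..n} \<and>
     (\<forall>a b c. subseq [a,b,c] p \<longrightarrow> a < b \<longrightarrow> \<not> b < c)"
  unfolding avoiders_def avoids_123_iff permutations_of_set_def by blast

text \<open>Being the maximum, \<open>Suc n\<close> can only play the 3 of a 123, so the insertion
  creates a pattern exactly when an ascending pair stands in front of it.\<close>

lemma insert_max_in_avoiders_123_iff:
  "u @ Suc n # v \<in> avoiders [1,2,3] (Suc n) \<longleftrightarrow>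
     u @ v \<in> avoiders [1,2,3] n \<and> sorted_wrt (>) u"
proof (cases "distinct (u @ v) \<and> set (u @ v) = {1..n}")
  case True
  then have uv: "distinct (u @ v)" "set (u @ v) = {1..n}"
    by blast+
  have less: "x < Suc n" if "x \<in> set (u @ v)" for x
    using that unfolding uv(2) by simp
  then have "Suc n \<notin> set (u @ v)" by blast
  then have d: "distinct (u @ Suc n # v)" using uv(1) by simp
  have "set (u @ Suc n # v) = insert (Suc n) (set (u @ v))" by simp
  also have "\<dots> = {1..Suc n}" unfolding uv(2) by auto
  finally have d': "set (u @ Suc n # v) = {1..Suc n}" .
  have split: "subseq xs (Suc n # v) \<longleftrightarrow> subseq xs v \<or>
      (\<exists>ys. xs = Suc n # ys \<and> subseq ys v)" for xs
    by (cases xs) (auto simp: subseq_Cons')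
  have "(\<forall>a b c. subseq [a,b,c] (u @ Suc n # v) \<longrightarrow> a < b \<longrightarrow> \<not> b < c) \<longleftrightarrow>
        (\<forall>a b c. subseq [a,b,c] (u @ v) \<longrightarrow> a < b \<longrightarrow> \<not> b < c) \<and>
        (\<forall>a b. subseq [a,b] u \<longrightarrow> \<not> a < b)"
    (is "?L \<longleftrightarrow> ?R1 \<and> ?R2")
  proof
    assume L: ?L
    have ?R1
      using L by (metis subseq_append_cases(2) split list.set_intros(2))
    moreover have ?R2
    proof (intro allI impI notI)
      fix a b assume ab: "subseq [a,b] u" "a < b"
      then have "subseq [a,b,Suc n] (u @ Suc n # v)"
        unfolding subseq_append_cases by simp
      moreover have "b < Suc n" using set_mono_subseq[OF ab(1)] less by auto
      ultimately show False using L ab(2) by blast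
    qed
    ultimately show "?R1 \<and> ?R2" ..
  next
    assume R: "?R1 \<and> ?R2"
    show ?L
    proof (intro allI impI notI)
      fix a b c assume *: "subseq [a,b,c] (u @ Suc n # v)" "a < b" "b < c"
      have "c \<in> set (u @ Suc n # v)" using set_mono_subseq[OF *(1)] by simp
      then have "c \<le> Suc n" using less by force
      \<comment> \<open>Since a < b < c, only c can be \<open>Suc n\<close>; in that case a and b
        both come from \<open>u\<close>.\<close>
      then have "a \<noteq> Suc n" "b \<noteq> Suc n" using * by auto
      then have "subseq [a,b,c] (u @ v) \<or> subseq [a,b] u"
        using *(1) unfolding subseq_append_cases split by auto
      then show False using R *(2,3) by blast
    qed
  qed
  moreover have "distinct u" using True by simp
  ultimately show ?thesis
    using True d d' unfolding in_avoiders_123_iff by (simp add: sorted_wrt_greater_iff_subseq)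
next
  case False
  have "\<not> (distinct (u @ Suc n # v) \<and> set (u @ Suc n # v) = {1..Suc n})"
  proof
    assume *: "distinct (u @ Suc n # v) \<and> set (u @ Suc n # v) = {1..Suc n}"
    then have "distinct (u @ v)" "Suc n \<notin> set (u @ v)" by simp_all
    moreover have "insert (Suc n) (set (u @ v)) = insert (Suc n) {1..n}"
      using * by (simp add: atLeastAtMostSuc_conv)
    moreover have "Suc n \<notin> {1..n}" by simp
    ultimately show False using False by (metis insert_ident)
  qed
  with False show ?thesis unfolding in_avoiders_123_iff by metis
qed

section \<open>Avoiders by initial decreasing run, and ballot numbers\<close>

text \<open>\<open>j\<close> is a lower bound on the run length, so exact lengths are differences of
  consecutive sets. The bound \<open>j \<le> n\<close> empties the set for larger \<open>j\<close>,
  where \<open>take j p\<close> would be just \<open>p\<close>.\<close>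

definition decreasing_start_avoiders :: "nat \<Rightarrow> nat \<Rightarrow> nat list set" where
  "decreasing_start_avoiders n j =
     {p \<in> avoiders [1,2,3] n. j \<le> n \<and> sorted_wrt (>) (take j p)}"

lemma finite_decreasing_start_avoiders: "finite (decreasing_start_avoiders n j)"
  by (simp add: decreasing_start_avoiders_def finite_avoiders)

lemma decreasing_start_avoiders_antimono:
  assumes "i \<le> j"
  shows "decreasing_start_avoiders n j \<subseteq> decreasing_start_avoiders n i"
proof
  fix p assume "p \<in> decreasing_start_avoiders n j"
  moreover have "take j p = take i p @ take (j - i) (drop i p)"
    using assms by (metis le_add_diff_inverse take_add)
  ultimately show "p \<in> decreasing_start_avoiders n i"
    using assms by (auto simp: decreasing_start_avoiders_def sorted_wrt_append)
qed

lemma Cons_max_in_decreasing_start_avoiders_iff: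
  "Suc n # v \<in> decreasing_start_avoiders (Suc n) (Suc j) \<longleftrightarrow> v \<in> decreasing_start_avoiders n j"
proof -
  have "Suc n # v \<in> avoiders [1,2,3] (Suc n) \<longleftrightarrow> v \<in> avoiders [1,2,3] n"
    using insert_max_in_avoiders_123_iff[of "[]"] by simp
  moreover have "\<forall>x\<in>set (take j v). x < Suc n" if "v \<in> avoiders [1,2,3] n"
    using that by (auto simp: in_avoiders_123_iff dest: in_set_takeD)
  ultimately show ?thesis
    by (auto simp: decreasing_start_avoiders_def)
qed

text \<open>Avoidance makes \<open>u\<close> decreasing, and the step from its last entry to
  \<open>Suc n\<close> is an ascent. Hence the initial run of the new word is exactly
  \<open>u\<close>.\<close>

lemma insert_max_in_decreasing_start_avoiders_iff:
  assumes "u \<noteq> []"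
  shows "u @ Suc n # v \<in> decreasing_start_avoiders (Suc n) j \<longleftrightarrow>
         u @ v \<in> decreasing_start_avoiders n (length u) \<and> j \<le> length u"
proof (cases "u @ Suc n # v \<in> avoiders [1,2,3] (Suc n)")
  case True
  then have uv: "u @ v \<in> avoiders [1,2,3] n" "sorted_wrt (>) u"
    by (simp_all only: insert_max_in_avoiders_123_iff)
  have n: "length u \<le> n" using length_avoiders[OF uv(1)] by simp
  have "hd u \<in> set u" using assms by simp
  moreover have "set u \<subseteq> {1..n}" using uv(1) by (auto simp: in_avoiders_123_iff)
  ultimately have hd: "hd u < Suc n" by auto
  show ?thesis
  proof (cases "j \<le> length u")
    case le: True
    have "u = take j u @ drop j u" by simp
    then have "sorted_wrt (>) (take j u)" using uv(2) by (metis sorted_wrt_append)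
    then show ?thesis
      using True uv n le by (simp add: decreasing_start_avoiders_def)
  next
    case False
    \<comment> \<open>\<open>sorted_wrt\<close> compares all pairs, so any entry of \<open>u\<close>
      smaller than \<open>Suc n\<close> refutes it; \<open>hd u\<close> serves.\<close>
    then have "\<not> sorted_wrt (>) (take j (u @ Suc n # v))"
      using hd \<open>hd u \<in> set u\<close> by (auto simp: sorted_wrt_append take_Cons' intro!: bexI[of _ "hd u"])
    then show ?thesis using False by (simp add: decreasing_start_avoiders_def)
  qed
next
  case False
  then show ?thesis
    by (auto simp: insert_max_in_avoiders_123_iff decreasing_start_avoiders_def)
qed

text \<open>
  Inserting \<open>n + 1\<close> in front of an avoider lengthens its initial decreasing run by one, and
  inserting it behind the first \<open>j \<ge> 1\<close> entries cuts that run to length \<open>j\<close>.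
\<close>

lemma decreasing_start_avoiders_diff:
  "decreasing_start_avoiders (Suc n) (Suc j) - decreasing_start_avoiders (Suc n) (Suc (Suc j)) =
   (#) (Suc n) ` (decreasing_start_avoiders n j - decreasing_start_avoiders n (Suc j)) \<union>
   (\<lambda>p. take (Suc j) p @ Suc n # drop (Suc j) p) ` decreasing_start_avoiders n (Suc j)"
  (is "?L = ?M \<union> ?N")
proof (intro equalityI subsetI)
  fix q assume q: "q \<in> ?L"
  then have "Suc n \<in> set q"
    by (auto simp: decreasing_start_avoiders_def in_avoiders_123_iff)
  then obtain u v where uv: "q = u @ Suc n # v" by (auto simp: in_set_conv_decomp)
  show "q \<in> ?M \<union> ?N"
  proof (cases "u = []")
    case True
    then show ?thesis using q uv by (auto simp: Cons_max_in_decreasing_start_avoiders_iff)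
  next
    case False
    \<comment> \<open>Membership for the bound \<open>Suc j\<close> but not for
      \<open>Suc (Suc j)\<close> pins down the length of \<open>u\<close>.\<close>
    then have "u @ v \<in> decreasing_start_avoiders n (length u)" "length u = Suc j"
      using q by (auto simp: uv insert_max_in_decreasing_start_avoiders_iff)
    then have "q \<in> ?N" by (intro image_eqI[of _ _ "u @ v"]) (auto simp: uv)
    then show ?thesis ..
  qed
next
  fix q assume "q \<in> ?M \<union> ?N"
  then show "q \<in> ?L"
  proof
    assume "q \<in> ?M"
    then show ?thesis by (auto simp: Cons_max_in_decreasing_start_avoiders_iff)
  next
    assume "q \<in> ?N"
    then obtain p where p: "q = take (Suc j) p @ Suc n # drop (Suc j) p"
        "p \<in> decreasing_start_avoiders n (Suc j)"
      by auto
    then have len: "length (take (Suc j) p) = Suc j"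
      by (auto simp: decreasing_start_avoiders_def dest: length_avoiders)
    then have "take (Suc j) p \<noteq> []" by (metis list.size(3) nat.distinct(1))
    from insert_max_in_decreasing_start_avoiders_iff[OF this, of n "drop (Suc j) p"]
    show ?thesis using p len by simp
  qed
qed

text \<open>Writing r(n,j) for the cardinalities, the two kinds of insertion give r(n+1,j+1) -
  r(n+1,j+2) = (r(n,j) - r(n,j+1)) + r(n,j+1), which collapses to r(n,j).\<close>

lemma card_decreasing_start_avoiders_Suc:
  "card (decreasing_start_avoiders (Suc n) (Suc j)) =
   card (decreasing_start_avoiders (Suc n) (Suc (Suc j))) + card (decreasing_start_avoiders n j)"
proof -
  let ?R = decreasing_start_avoiders
  let ?ins = "\<lambda>p. take (Suc j) p @ Suc n # drop (Suc j) p"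
  have notin: "Suc n \<notin> set p" if "p \<in> ?R n i" for p i
    using that by (auto simp: decreasing_start_avoiders_def in_avoiders_123_iff)
  \<comment> \<open>Deleting the maximum undoes the insertion.\<close>
  have "remove1 (Suc n) (?ins p) = p" if "p \<in> ?R n (Suc j)" for p
    using notin[OF that] by (auto simp: remove1_append dest: in_set_takeD)
  then have inj: "inj_on ?ins (?R n (Suc j))"
    by (rule inj_on_inverseI)
  \<comment> \<open>At least one entry of \<open>p\<close> stays in front, so the first entry tells
    the two images apart.\<close>
  have hd: "hd (?ins p) \<noteq> Suc n" if "p \<in> ?R n (Suc j)" for p
  proof -
    have "p \<noteq> []" using that
      by (auto simp: decreasing_start_avoiders_def dest: length_avoiders)
    then show ?thesis using notin[OF that] by (cases p) auto
  qed
  then have disj: "(#) (Suc n) ` (?R n j - ?R n (Suc j)) \<inter> ?ins ` ?R n (Suc j) = {}"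
    by (metis (no_types, lifting) disjoint_iff imageE list.sel(1))
  have le: "card (?R n (Suc j)) \<le> card (?R n j)"
    by (intro card_mono finite_decreasing_start_avoiders decreasing_start_avoiders_antimono) simp
  have "card (?R (Suc n) (Suc j)) - card (?R (Suc n) (Suc (Suc j))) =
        card (?R (Suc n) (Suc j) - ?R (Suc n) (Suc (Suc j)))"
    by (intro card_Diff_subset[symmetric] finite_decreasing_start_avoiders
        decreasing_start_avoiders_antimono) simp
  also have "\<dots> = card ((#) (Suc n) ` (?R n j - ?R n (Suc j))) + card (?ins ` ?R n (Suc j))"
    unfolding decreasing_start_avoiders_diff using disj
    by (intro card_Un_disjoint) (simp_all add: finite_decreasing_start_avoiders)
  also have "\<dots> = card (?R n j - ?R n (Suc j)) + card (?R n (Suc j))"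
    using inj by (simp add: card_image)
  also have "card (?R n j - ?R n (Suc j)) = card (?R n j) - card (?R n (Suc j))"
    by (intro card_Diff_subset finite_decreasing_start_avoiders
        decreasing_start_avoiders_antimono) simp
  finally have "card (?R (Suc n) (Suc j)) - card (?R (Suc n) (Suc (Suc j))) = card (?R n j)"
    using le by simp
  moreover have "card (?R (Suc n) (Suc (Suc j))) \<le> card (?R (Suc n) (Suc j))"
    by (intro card_mono finite_decreasing_start_avoiders decreasing_start_avoiders_antimono) simp
  ultimately show ?thesis by simp
qed

lemma decreasing_start_avoiders_0: "decreasing_start_avoiders n 0 = avoiders [1,2,3] n"
  by (simp add: decreasing_start_avoiders_def)

text \<open>The recurrence yields only positive bounds. A nonempty word has an initial run of length
  at least 1, so the bound 0 is recovered from the bound 1.\<close>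

lemma decreasing_start_avoiders_Suc_0:
  "decreasing_start_avoiders (Suc n) (Suc 0) = avoiders [1,2,3] (Suc n)"
proof -
  have "sorted_wrt (>) (take (Suc 0) p)" for p :: "nat list"
    by (cases p) simp_all
  then show ?thesis
    by (simp add: decreasing_start_avoiders_def)
qed

text \<open>The ballot number \<open>(2n - j choose n) - (2n - j choose n + 1)\<close>, free of subtraction.\<close>

lemma card_decreasing_start_avoiders:
  assumes "j \<le> n"
  shows "card (decreasing_start_avoiders n j) + (2 * n - j choose Suc n) = (2 * n - j choose n)"
  using assms
proof (induction n arbitrary: j)
  case 0
  have "avoiders [1,2,3] 0 = {[]}"
    by (auto simp: in_avoiders_123_iff)
  then show ?case using 0
    by (simp add: decreasing_start_avoiders_def)
next
  case (Suc n)
  \<comment> \<open>The claim for the bound \<open>Suc j\<close>, by downward induction on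
    \<open>j\<close>. At \<open>j = Suc n\<close> the bound exceeds the word length and both
    binomials vanish; each further step adds the two induction hypotheses by Pascal's rule.\<close>
  have pos: "card (decreasing_start_avoiders (Suc n) (Suc j)) + (2 * n + 1 - j choose Suc (Suc n)) =
      (2 * n + 1 - j choose Suc n)" if "j \<le> Suc n" for j
    using that
  proof (induction j rule: inc_induct)
    case base
    then show ?case by (simp add: decreasing_start_avoiders_def binomial_eq_0)
  next
    case (step j)
    have "2 * n + 1 - j = Suc (2 * n - j)" "2 * n + 1 - Suc j = 2 * n - j"
      using step by auto
    then show ?case
      using step.IH Suc.IH[of j] step.hyps card_decreasing_start_avoiders_Suc[of n j] by simp
  qed
  show ?case
  proof (cases j)
    case 0
    \<comment> \<open>The bounds 0 and 1 have the same set but upper arguments 2n+2 and 2n+1. After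
      Pascal's rule the surplus terms on the two sides agree by this symmetry.\<close>
    have "(2 * n + 1 choose n) = (2 * n + 1 choose Suc n)"
      using binomial_symmetric[of n "2 * n + 1"] by (simp add: Suc_eq_plus1)
    moreover have "card (avoiders [1,2,3] (Suc n)) + (2 * n + 1 choose Suc (Suc n)) =
        (2 * n + 1 choose Suc n)"
      using pos[of 0] by (simp only: decreasing_start_avoiders_Suc_0 diff_zero le0)
    moreover have "2 * Suc n - j = Suc (2 * n + 1)"
      using 0 by simp
    ultimately show ?thesis
      unfolding 0 decreasing_start_avoiders_0 by (simp only: binomial_Suc_Suc)
  next
    case (Suc i)
    then have "i \<le> Suc n" and "2 * Suc n - j = 2 * n + 1 - i"
      using Suc.prems by (simp_all add: One_nat_def)
    then show ?thesis using pos[of i] by (simp only: Suc)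
  qed
qed

text \<open>For \<open>j = 0\<close> the ballot number is \<open>2 * n choose n\<close> minus
  \<open>2 * n choose Suc n\<close>. The latter is n/(n+1) times the former, which leaves the factor
  1/(n+1).\<close>

lemma card_avoiders_123: "real (card (avoiders [1,2,3] n)) = catalan n"
proof -
  have "card (avoiders [1,2,3] n) + (2 * n choose Suc n) = (2 * n choose n)"
    using card_decreasing_start_avoiders[of 0 n] by (simp add: decreasing_start_avoiders_0)
  then have card: "real (card (avoiders [1,2,3] n)) =
      real (2 * n choose n) - real (2 * n choose Suc n)"
    by (metis add_diff_cancel_right' of_nat_add)
  \<comment> \<open>Both sides equal \<open>2 * n * (2 * n - 1 choose n)\<close> by
    absorption.\<close>
  have "Suc n * (2 * n choose Suc n) = (2 * n - n) * (2 * n choose n)"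
    by (simp only: binomial_absorb_comp binomial_absorption)
  then have "Suc n * (2 * n choose Suc n) = n * (2 * n choose n)"
    by simp
  then have "real (Suc n) * real (2 * n choose Suc n) = real n * real (2 * n choose n)"
    by (metis of_nat_mult)
  then show ?thesis
    unfolding card catalan_def by (simp add: field_simps)
qed

section \<open>Decomposable 123-avoiders\<close>

lemma set_rev_upt_Suc: "set (rev [k..<Suc n]) = {k..n}"
  by auto

lemma sorted_wrt_rev_upt: "sorted_wrt (>) (rev [m..<n])"
  by (simp add: sorted_wrt_rev)

text \<open>The full length is always a candidate for the \<open>LEAST\<close>, so the least one
  falls short of it exactly when a smaller candidate exists.\<close>

lemma not_indecomposable_iff:
  assumes "set p = {1..n}" "length p = n" "n \<ge> 1"
  shows "\<not> indecomposable p \<longleftrightarrow> (\<exists>k. 1 \<le> k \<and> k < n \<and> set (take k p) = {1..k})"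
proof -
  let ?P = "\<lambda>i. 1 \<le> i \<and> i \<le> length p \<and> set (take i p) = {1..i}"
  have n: "?P n" using assms by simp
  have first: "?P (first_block p)"
    unfolding first_block_def using n by (rule LeastI)
  have least: "first_block p \<le> k" if "?P k" for k
    unfolding first_block_def using that by (rule Least_le)
  have "p \<noteq> []" using assms by auto
  then show ?thesis
    using first least assms(2) unfolding indecomposable_def
    by (metis le_neq_implies_less less_imp_le_nat leD)
qed

text \<open>For \<open>k \<le> n\<close> this is the direct sum of the decreasing permutations of
  lengths k and n - k, that is, k ... 1 n ... k+1.\<close>

definition two_blocks :: "nat \<Rightarrow> nat \<Rightarrow> nat list" where
  "two_blocks n k = rev [1..<Suc k] @ rev [Suc k..<Suc n]"

text \<open>A prefix with entries 1, ..., k leaves k+1, ..., n behind it. Once both parts are known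
  to decrease, their sets determine them, so k alone parametrizes these permutations.\<close>

lemma decomposable_avoiders_123:
  assumes "n \<ge> 1"
  shows "avoiders [1,2,3] n - indec_avoiders [1,2,3] n = two_blocks n ` {1..<n}"
proof (intro equalityI subsetI)
  fix p assume p: "p \<in> avoiders [1,2,3] n - indec_avoiders [1,2,3] n"
  then have av: "p \<in> avoiders [1,2,3] n" and "\<not> indecomposable p"
    by (auto simp: indec_avoiders_def)
  moreover have dist: "distinct p" "set p = {1..n}" "length p = n"
    and no: "\<And>a b c. subseq [a,b,c] p \<Longrightarrow> a < b \<Longrightarrow> \<not> b < c"
    using av length_avoiders[OF av] by (auto simp: in_avoiders_123_iff)
  ultimately obtain k where k: "1 \<le> k" "k < n" "set (take k p) = {1..k}"
    using not_indecomposable_iff assms by metis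
  define u v where "u = take k p" and "v = drop k p"
  have p_uv: "p = u @ v" by (simp add: u_def v_def)
  have "distinct (u @ v)"
    using dist(1) by (simp only: p_uv)
  then have u: "set u = {1..k}" "distinct u" and "distinct v" "set u \<inter> set v = {}"
    using k(3) by (simp_all add: u_def)
  have "set v = {1..n} - {1..k}"
    using dist(2) u(1) \<open>set u \<inter> set v = {}\<close> unfolding p_uv by auto
  then have v: "set v = {Suc k..n}" using k by auto
  have "sorted_wrt (>) u"
    unfolding sorted_wrt_greater_iff_subseq[OF \<open>distinct u\<close>]
  proof (intro allI impI notI)
    fix a b assume ab: "subseq [a,b] u" "a < b"
    \<comment> \<open>\<open>n\<close> lies behind \<open>u\<close> and above its entries, so it
      completes an ascending pair of \<open>u\<close> to a 123.\<close>
    have "n \<in> set v" using v k by simp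
    then have "subseq [a,b,n] p" using ab unfolding p_uv subseq_append_cases by simp
    moreover have "b \<in> set u" using set_mono_subseq[OF ab(1)] by simp
    then have "b < n" using u k by simp
    ultimately show False using no[OF _ ab(2)] by blast
  qed
  then have "u = rev [1..<Suc k]"
    using u(1) set_rev_upt_Suc by (intro sorted_wrt_greater_unique sorted_wrt_rev_upt) metis+
  moreover have "sorted_wrt (>) v"
    unfolding sorted_wrt_greater_iff_subseq[OF \<open>distinct v\<close>]
  proof (intro allI impI notI)
    fix a b assume ab: "subseq [a,b] v" "a < b"
    \<comment> \<open>Symmetrically, 1 lies in front of \<open>v\<close> and below its
      entries.\<close>
    have "1 \<in> set u" unfolding u(1) using k(1) by simp
    then have "subseq [1,a,b] p" using ab unfolding p_uv subseq_append_cases by simp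
    moreover have "a \<in> set v" using set_mono_subseq[OF ab(1)] by simp
    then have "Suc k \<le> a" unfolding v by simp
    then have "1 < a" using k(1) by linarith
    ultimately have "\<not> a < b" by (rule no)
    then show False using ab(2) by contradiction
  qed
  then have "v = rev [Suc k..<Suc n]"
    using v set_rev_upt_Suc by (intro sorted_wrt_greater_unique sorted_wrt_rev_upt) metis+
  ultimately have "p = two_blocks n k" by (simp only: p_uv two_blocks_def)
  then show "p \<in> two_blocks n ` {1..<n}" using k by simp
next
  fix p assume "p \<in> two_blocks n ` {1..<n}"
  then obtain k where k: "1 \<le> k" "k < n" and p: "p = two_blocks n k" by auto
  have set: "set p = {1..n}" and dist: "distinct p"
    using k by (auto simp: p two_blocks_def)
  have "\<not> b < c" if "subseq [a,b,c] p" "a < b" for a b c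
  proof -
    \<comment> \<open>Three letters over two blocks: a, b or b, c share a block, and the blocks
      decrease.\<close>
    have "subseq [b,c] (rev [Suc k..<Suc n]) \<or> subseq [b,c] (rev [1..<Suc k]) \<or>
        subseq [a,b] (rev [1..<Suc k])"
      using that(1) unfolding p two_blocks_def subseq_append_cases
      by (blast dest: subseq_Cons')
    then show ?thesis
      using that(2) sorted_wrt_greater_subseq[OF sorted_wrt_rev_upt] by (metis less_asym)
  qed
  then have av: "p \<in> avoiders [1,2,3] n" using set dist by (auto simp: in_avoiders_123_iff)
  have "set (take k p) = {1..k}" by (auto simp: p two_blocks_def)
  then have "\<not> indecomposable p"
    using not_indecomposable_iff[OF set length_avoiders[OF av] assms] k by blast
  then show "p \<in> avoiders [1,2,3] n - indec_avoiders [1,2,3] n"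
    using av by (simp add: indec_avoiders_def)
qed

text \<open>The first block is nonempty and starts with its maximum, so \<open>hd\<close> recovers
  \<open>k\<close>.\<close>

lemma inj_on_two_blocks: "inj_on (two_blocks n) {1..<n}"
  by (rule inj_on_inverseI[of _ hd]) (simp add: two_blocks_def)

text \<open>Of the n - 1 adjacent pairs, only the one where the blocks meet is an ascent.\<close>

lemma descents_two_blocks:
  assumes "k \<in> {1..<n}"
  shows "descents (two_blocks n k) = n - 2"
proof -
  have nth: "two_blocks n k ! i = (if i < k then k - i else n + k - i)" if "i < n" for i
    using that assms by (auto simp: two_blocks_def nth_append rev_nth simp del: upt_Suc)
  have len: "length (two_blocks n k) = n"
    using assms by (simp add: two_blocks_def del: upt_Suc)
  \<comment> \<open>Positions count from 0, so the seam lies between \<open>k - 1\<close> and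
    \<open>k\<close>.\<close>
  have "{i. Suc i < length (two_blocks n k) \<and> two_blocks n k ! i > two_blocks n k ! Suc i} =
        {..<n - 1} - {k - 1}"
    using assms by (auto simp: len nth split: if_splits)
  moreover have "k - 1 < n - 1" using assms by auto
  ultimately show ?thesis
    unfolding descents_def by simp
qed

text \<open>All decomposable avoiders share one descent number. For \<open>n = 1\<close> the
  truncated \<open>n - 2\<close> is 0, but the added term \<open>n - 1\<close> is 0 as well.\<close>

lemma A_num_123:
  assumes "n \<ge> 1"
  shows "A_num [1,2,3] n i = I_num [1,2,3] n i + (if i = n - 2 then n - 1 else 0)"
proof -
  let ?A = "avoiders [1,2,3] n" and ?I = "indec_avoiders [1,2,3] n"
  have "?A = ?I \<union> two_blocks n ` {1..<n}" "?I \<inter> two_blocks n ` {1..<n} = {}"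
    using decomposable_avoiders_123[OF assms] by (auto simp: indec_avoiders_def)
  then have A: "{p \<in> ?A. descents p = i} =
      {p \<in> ?I. descents p = i} \<union> {p \<in> two_blocks n ` {1..<n}. descents p = i}"
    and disj: "{p \<in> ?I. descents p = i} \<inter> {p \<in> two_blocks n ` {1..<n}. descents p = i} = {}"
    by blast+
  have "{p \<in> two_blocks n ` {1..<n}. descents p = i} =
      (if i = n - 2 then two_blocks n ` {1..<n} else {})"
    by (auto simp: descents_two_blocks)
  then have "card {p \<in> two_blocks n ` {1..<n}. descents p = i} = (if i = n - 2 then n - 1 else 0)"
    by (simp add: card_image[OF inj_on_two_blocks])
  then show ?thesis
    unfolding A_num_def I_num_def A
    by (subst card_Un_disjoint[OF _ _ disj]) (simp_all add: finite_indec_avoiders)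
qed

lemma card_indec_avoiders_123:
  assumes "n \<ge> 1"
  shows "real (card (indec_avoiders [1,2,3] n)) = catalan n - (real n - 1)"
proof -
  have sub: "indec_avoiders [1,2,3] n \<subseteq> avoiders [1,2,3] n"
    by (auto simp: indec_avoiders_def)
  have "card (avoiders [1,2,3] n - indec_avoiders [1,2,3] n) = n - 1"
    by (simp add: decomposable_avoiders_123[OF assms] card_image[OF inj_on_two_blocks])
  then have "card (avoiders [1,2,3] n) = card (indec_avoiders [1,2,3] n) + (n - 1)"
    using card_Diff_subset[OF finite_indec_avoiders sub] card_mono[OF finite_avoiders sub]
    by simp
  then show ?thesis
    using assms card_avoiders_123[of n] by (simp add: of_nat_diff)
qed

section \<open>Generating function of the decomposable avoiders\<close>

text \<open>A general ring lets \<open>c\<close> be both the variable q, a series itself, and the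
  number 1.\<close>

lemma fps_geometric_mult:
  fixes c :: "'a::comm_ring_1"
  shows "(1 - fps_X * fps_const c) * Abs_fps (\<lambda>n. c ^ n) = 1"
proof (rule fps_ext)
  fix n
  show "fps_nth ((1 - fps_X * fps_const c) * Abs_fps (\<lambda>n. c ^ n)) n = fps_nth 1 n"
    by (cases n) (simp_all add: algebra_simps)
qed

lemma fps_geometric_power2:
  fixes c :: "'a::comm_ring_1"
  shows "(Abs_fps (\<lambda>n. c ^ n))\<^sup>2 = Abs_fps (\<lambda>n. of_nat (Suc n) * c ^ n)"
proof (rule fps_ext)
  fix n
  have "(\<Sum>i=0..n. c ^ i * c ^ (n - i)) = (\<Sum>i=0..n. c ^ n)"
    by (intro sum.cong) (simp_all flip: power_add)
  then show "fps_nth ((Abs_fps (\<lambda>n. c ^ n))\<^sup>2) n =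
      fps_nth (Abs_fps (\<lambda>n. of_nat (Suc n) * c ^ n)) n"
    by (simp add: power2_eq_square fps_mult_nth)
qed

text \<open>Multiplication by \<open>fps_X\<^sup>2\<close> shifts the coefficients (n+1) c^n by two
  places. For \<open>n < 2\<close> the truncated \<open>n - 1\<close> is 0, in agreement with the
  vanishing coefficient.\<close>

lemma fps_X2_times_geometric_nth:
  fixes c :: "'a::comm_ring_1"
  shows "fps_nth (fps_X\<^sup>2 * (Abs_fps (\<lambda>n. c ^ n))\<^sup>2) n = of_nat (n - 1) * c ^ (n - 2)"
proof (cases "n < 2")
  case True
  then have "n - 1 = 0" by simp
  then show ?thesis using True
    by (simp add: fps_X_power_mult_nth)
next
  case False
  then have "Suc (n - 2) = n - 1" by simp
  then show ?thesis using False
    by (simp only: fps_X_power_mult_nth fps_geometric_power2) simp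
qed

lemma decomposable_gf_nth:
  "fps_nth (var_x\<^sup>2 / (1 - var_x * var_q)\<^sup>2) n = of_nat (n - 1) * fps_X ^ (n - 2)"
proof -
  let ?D = "(1 - var_x * var_q)\<^sup>2" and ?H = "Abs_fps (\<lambda>n. fps_X ^ n) :: real fps fps"
  have "?D * ?H\<^sup>2 = 1"
    by (simp only: fps_geometric_mult flip: power_mult_distrib) simp
  \<comment> \<open>The coefficients are series in q and form no field, so the inverse is identified
    through associativity and \<open>inverse_denominator\<close>.\<close>
  then have "inverse ?D = inverse ?D * (?D * ?H\<^sup>2)"
    by (simp only: mult_1_right)
  also have "\<dots> = (?D * inverse ?D) * ?H\<^sup>2"
    by (simp only: ac_simps)
  also have "\<dots> = ?H\<^sup>2"
    by (simp only: inverse_denominator(1) mult_1_left)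
  finally have "inverse ?D = ?H\<^sup>2" .
  then show ?thesis
    by (simp only: inverse_denominator(2) fps_X2_times_geometric_nth)
qed

lemma decomposable_gf1_nth:
  "fps_nth ((fps_X :: real fps)\<^sup>2 / (1 - fps_X)\<^sup>2) n = real (n - 1)"
proof -
  let ?H = "Abs_fps (\<lambda>n. 1 ^ n) :: real fps"
  have "(1 - fps_X) * ?H = 1"
    using fps_geometric_mult[of "1::real"] by simp
  then have "(1 - fps_X)\<^sup>2 * ?H\<^sup>2 = 1"
    by (metis power_mult_distrib power_one)
  then have "inverse ((1 - fps_X)\<^sup>2) = ?H\<^sup>2"
    by (rule fps_inverse_unique)
  moreover have "fps_nth ((1 - fps_X :: real fps)\<^sup>2) 0 \<noteq> 0"
    by (simp add: fps_power_zeroth)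
  ultimately have "fps_X\<^sup>2 / (1 - fps_X)\<^sup>2 = fps_X\<^sup>2 * ?H\<^sup>2"
    by (simp add: fps_divide_unit)
  then show ?thesis
    by (simp only: fps_X2_times_geometric_nth) simp
qed

text \<open>Comparison of the coefficients of x^n q^i; the summand 1 accounts for the empty
  permutation.\<close>

lemma A_gf_123: "A_gf [1,2,3] = I_gf [1,2,3] + var_x\<^sup>2 / (1 - var_x * var_q)\<^sup>2 + 1"
proof (rule fps_ext)
  fix n
  show "fps_nth (A_gf [1,2,3]) n =
      fps_nth (I_gf [1,2,3] + var_x\<^sup>2 / (1 - var_x * var_q)\<^sup>2 + 1) n"
  proof (cases "n \<ge> 1")
    case True
    have "fps_of_poly (A_poly [1,2,3] n) =
        fps_of_poly (I_poly [1,2,3] n) + of_nat (n - 1) * fps_X ^ (n - 2)"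
    proof (rule fps_ext)
      fix i
      have "fps_nth (of_nat (n - 1) * fps_X ^ (n - 2) :: real fps) i =
          (if i = n - 2 then real (n - 1) else 0)"
        by (simp flip: fps_of_nat)
      then show "fps_nth (fps_of_poly (A_poly [1,2,3] n)) i =
          fps_nth (fps_of_poly (I_poly [1,2,3] n) + of_nat (n - 1) * fps_X ^ (n - 2)) i"
        by (simp only: fps_add_nth fps_of_poly_nth coeff_A_poly coeff_I_poly A_num_123[OF True])
          simp
    qed
    then show ?thesis
      using True by (simp only: A_gf_def I_gf_def fps_add_nth decomposable_gf_nth) simp
  next
    case False
    then show ?thesis
      by (simp only: A_gf_def I_gf_def fps_add_nth decomposable_gf_nth) simp
  qed
qed

section \<open>The Catalan series and the binomial series of (1-4x)^(1/2)\<close>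

text \<open>Two absorption steps lead from \<open>2 * n + 2 choose Suc n\<close> down to
  \<open>2 * n choose n\<close>.\<close>

lemma catalan_Suc: "catalan (Suc n) = 2 * (2 * real n + 1) / (real n + 2) * catalan n"
proof -
  have eqs: "2 * n + 2 - 1 = 2 * n + 1" "2 * n + 1 - n = Suc n" "2 * n + 1 - 1 = 2 * n"
    by simp_all
  have 1: "Suc n * (2 * n + 2 choose Suc n) = (2 * n + 2) * (2 * n + 1 choose n)"
    using binomial_absorption[of n "2 * n + 2"] unfolding eqs .
  have 2: "Suc n * (2 * n + 1 choose n) = (2 * n + 1) * (2 * n choose n)"
    using binomial_absorb_comp[of "2 * n + 1" n] unfolding eqs .
  have "real (Suc n) * real (2 * n + 2 choose Suc n) = real (2 * n + 2) * real (2 * n + 1 choose n)"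
    using 1 by (metis of_nat_mult)
  moreover have "real (Suc n) * real (2 * n + 1 choose n) = real (2 * n + 1) * real (2 * n choose n)"
    using 2 by (metis of_nat_mult)
  ultimately have "real (2 * n + 2 choose Suc n) =
      2 * (2 * real n + 1) / (real n + 1) * real (2 * n choose n)"
    by (simp add: field_simps)
  then show ?thesis
    by (simp add: catalan_def)
qed

text \<open>The left side is the coefficient of x^(n+1) in (1-4x)^(1/2). Its successive ratio -4
  (1/2 - (n+1)) / (n+2) equals 2 (2n+1) / (n+2), the ratio of the Catalan numbers.\<close>

lemma gbinomial_half_catalan: "(-4) ^ Suc n * ((1/2 :: real) gchoose Suc n) = -2 * catalan n"
proof (induction n)
  case 0
  then show ?case by (simp add: catalan_def)
next
  case (Suc n)
  have "(1/2 :: real) gchoose Suc (Suc n) =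
      ((1/2) gchoose Suc n) * (1/2 - real (Suc n)) / (real n + 2)"
    using gbinomial_mult_1[of "1/2::real" "Suc n"] by (simp add: field_simps)
  moreover have "(-4) ^ Suc m * (g * a / b) = ((-4) ^ m * g) * (-4 * a / b)"
    for m and a b g :: real
    by simp
  ultimately have "(-4) ^ Suc (Suc n) * ((1/2 :: real) gchoose Suc (Suc n)) =
      ((-4) ^ Suc n * ((1/2) gchoose Suc n)) * (-4 * (1/2 - real (Suc n)) / (real n + 2))"
    by (simp only:)
  also have "\<dots> = -2 * catalan n * (-4 * (1/2 - real (Suc n)) / (real n + 2))"
    by (simp only: Suc.IH)
  also have "\<dots> = -2 * catalan (Suc n)"
    by (simp add: catalan_Suc field_simps)
  finally show ?case .
qed

text \<open>Both sides square to 1 - 4x, so they agree up to sign, and the constant term 1 fixes the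
  sign.\<close>

lemma fps_sqrt_catalan: "fps_sqrt (1 - 4 * fps_X) = 1 - 2 * fps_X * Abs_fps catalan"
proof -
  \<comment> \<open>\<open>?B\<close> is (1+x)^(1/2), and composing it with \<open>?L\<close>
    substitutes -4x for x.\<close>
  let ?B = "fps_binomial (1/2) :: real fps" and ?L = "fps_const (-4) * fps_X :: real fps"
  let ?S = "1 - 2 * fps_X * Abs_fps catalan"
  have "?B\<^sup>2 = 1 + fps_X"
    using fps_binomial_add_mult[of "1/2::real" "1/2"]
    by (simp add: power2_eq_square fps_binomial_1)
  moreover have "?B oo ?L = ?S"
  proof (rule fps_ext)
    fix n
    show "fps_nth (?B oo ?L) n = fps_nth ?S n"
    proof (cases n)
      case 0
      then show ?thesis by simp
    next
      case (Suc m)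
      then show ?thesis
        using gbinomial_half_catalan[of m]
        by (simp add: fps_compose_linear mult.assoc numeral_fps_const del: power_Suc)
    qed
  qed
  moreover have "(?B oo ?L)\<^sup>2 = ?B\<^sup>2 oo ?L"
    by (simp add: power2_eq_square fps_compose_mult_distrib)
  ultimately have "?S\<^sup>2 = (1 + fps_X) oo ?L"
    by metis
  also have "\<dots> = 1 - 4 * fps_X"
    by (simp add: fps_compose_add_distrib numeral_fps_const flip: fps_const_neg)
  finally have S: "?S\<^sup>2 = 1 - 4 * fps_X" .
  have sq: "(fps_sqrt (1 - 4 * fps_X))\<^sup>2 = 1 - 4 * fps_X"
    "fps_nth (fps_sqrt (1 - 4 * fps_X)) 0 = 1"
    by (intro fps_sqrt_square; simp)+
  then have "fps_sqrt (1 - 4 * fps_X) = ?S \<or> fps_sqrt (1 - 4 * fps_X) = - ?S"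
    using S by (metis power2_eq_iff)
  moreover have "fps_nth (- ?S) 0 \<noteq> 1" by simp
  ultimately show ?thesis using sq(2) by metis
qed

section \<open>The series of indecomposable avoiders\<close>

lemma I_gf1_123_nth:
  assumes "n \<ge> 1"
  shows "fps_nth (I_gf1 [1,2,3]) n = catalan n - (real n - 1)"
  using nth_I_gf1[OF assms] card_indec_avoiders_123[OF assms] by simp

lemma I_gf1_123:
  "I_gf1 [1,2,3] = (1 - fps_sqrt (1 - 4 * fps_X)) / (2 * fps_X) - fps_X\<^sup>2 / (1 - fps_X)\<^sup>2 - 1"
proof -
  have "(2 * fps_X :: real fps) \<noteq> 0"
    by simp
  then have "(1 - fps_sqrt (1 - 4 * fps_X)) / (2 * fps_X) = Abs_fps catalan"
    unfolding fps_sqrt_catalan by simp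
  moreover have "I_gf1 [1,2,3] = Abs_fps catalan - fps_X\<^sup>2 / (1 - fps_X)\<^sup>2 - 1"
  proof (rule fps_ext)
    fix n
    show "fps_nth (I_gf1 [1,2,3]) n =
        fps_nth (Abs_fps catalan - fps_X\<^sup>2 / (1 - fps_X)\<^sup>2 - 1) n"
    proof (cases "n \<ge> 1")
      case True
      then show ?thesis
        by (simp only: fps_sub_nth decomposable_gf1_nth I_gf1_123_nth) (simp add: of_nat_diff)
    next
      case False
      \<comment> \<open>Here \<open>catalan 0 = 1\<close> is cancelled by the final
        \<open>- 1\<close>, and the rational term contributes 0.\<close>
      then have "n = 0" by simp
      then show ?thesis
        by (simp only: fps_sub_nth decomposable_gf1_nth) (simp add: I_gf1_def catalan_def)
    qed
  qed
  ultimately show ?thesis by simp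
qed

theorem theorem3p5:
  shows "A_gf [1,2,3] = I_gf [1,2,3] + var_x\<^sup>2 / (1 - var_x * var_q)\<^sup>2 + 1 \<and>
         I_gf1 [1,2,3] =
           (1 - fps_sqrt (1 - 4 * fps_X)) / (2 * fps_X) - fps_X\<^sup>2 / (1 - fps_X)\<^sup>2 - 1 \<and>
         (\<forall>n::nat. n \<ge> 1 \<longrightarrow> fps_nth (I_gf1 [1,2,3]) n = catalan n - (real n - 1))"
  by (intro conjI allI impI A_gf_123 I_gf1_123 I_gf1_123_nth)

end
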